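(* Let $(a_n)_{n\ge 1}$ and $(b_n)_{n\ge 1}$ be sequences of positive integers and let $\tau$ be the value of the generalized continued fraction \[ \tau=\cfrac{a_1}{b_1+\cfrac{a_2}{b_2+\cdots}}. \] Let $B_n$ be the denominators of its convergents and $\Pi_n=\prod_{k=1}^n a_k$. Suppose \[ \lim_{n\to\infty}\frac{\log B_{n+1}}{\log B_n}=1 \] and \[ \limsup_{n\to\infty}\frac{\log \Pi_n}{\log B_n}\le \nu<1 . \] Then $\tau$ is irrational and \[ \mu_I(\tau)\le 2+\frac{\nu}{1-\nu}. \]
   Context: The numerators $A_n$ and denominators $B_n$ of the convergents are the integers defined by $A_0=0$, $B_0=1$, $A_1=a_1$, $B_1=b_1$ and $A_{n+2}=b_{n+2}A_{n+1}+a_{n+2}A_n$, $B_{n+2}=b_{n+2}B_{n+1}+a_{n+2}B_n$ for $n\ge 0$. The value of the generalized continued fraction is the limit $\lim_{n\to\infty}A_n/B_n$ (such a limit need not exist in general, but it does in all instances considered here). For a real number $\tau$, an irrationality exponent of $\tau$ is any $\mu$ for which there exist positive constants $c$ and $N_0$ such that $\left|\tau-\frac{M}{N}\right|\ge \frac{c}{N^{\mu}}$ for all $M,N\in\mathbb{Z}$ with $N\ge N_0$. The asymptotic irrationality exponent $\mu_I(\tau)$ is the infimum of all irrationality exponents $\mu$ of $\tau$, where the infimum of the empty set is $\infty$. *)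

theory Defs
  imports "HOL-Analysis.Analysis"
begin

text \<open>Partial numerators and denominators are indexed from 1; the values \<open>a 0\<close> and \<open>b 0\<close> are never used.\<close>

fun gcf_num :: "(nat \<Rightarrow> int) \<Rightarrow> (nat \<Rightarrow> int) \<Rightarrow> nat \<Rightarrow> int" where
  "gcf_num a b 0 = 0"
| "gcf_num a b (Suc 0) = a 1"
| "gcf_num a b (Suc (Suc n)) = b (n + 2) * gcf_num a b (Suc n) + a (n + 2) * gcf_num a b n"

fun gcf_den :: "(nat \<Rightarrow> int) \<Rightarrow> (nat \<Rightarrow> int) \<Rightarrow> nat \<Rightarrow> int" where
  "gcf_den a b 0 = 1"
| "gcf_den a b (Suc 0) = b 1"
| "gcf_den a b (Suc (Suc n)) = b (n + 2) * gcf_den a b (Suc n) + a (n + 2) * gcf_den a b n"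

definition gcf_convergent :: "(nat \<Rightarrow> int) \<Rightarrow> (nat \<Rightarrow> int) \<Rightarrow> nat \<Rightarrow> real" where
  "gcf_convergent a b n = real_of_int (gcf_num a b n) / real_of_int (gcf_den a b n)"

text \<open>Only meaningful if the sequence of convergents converges, since \<^const>\<open>lim\<close> is total.\<close>

definition gcf_value :: "(nat \<Rightarrow> int) \<Rightarrow> (nat \<Rightarrow> int) \<Rightarrow> real" where
  "gcf_value a b = lim (gcf_convergent a b)"

definition irrationality_exponent :: "real \<Rightarrow> real \<Rightarrow> bool" where
  "irrationality_exponent \<tau> \<mu> \<longleftrightarrow>
     (\<exists>c N0 :: real. c > 0 \<and> N0 > 0 \<and>
       (\<forall>M N :: int. real_of_int N \<ge> N0 \<longrightarrow>
          \<bar>\<tau> - real_of_int M / real_of_int N\<bar> \<ge> c / (real_of_int N powr \<mu>)))"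

text \<open>The infimum is taken in the extended reals, so that it is \<open>\<infinity>\<close> for the empty set.\<close>

definition asymptotic_irrationality_exponent :: "real \<Rightarrow> ereal" where
  "asymptotic_irrationality_exponent \<tau> = (INF \<mu>\<in>{\<mu>. irrationality_exponent \<tau> \<mu>}. ereal \<mu>)"

end

theory Submission
  imports Defs
begin

text \<open>
  Write \<open>A\<^sub>n\<close>, \<open>B\<^sub>n\<close> for the numerators and denominators of the convergents and
  \<open>\<Pi>\<^sub>n\<close> for the product of the first \<open>n\<close> partial numerators.  The determinant identity
  \<open>A\<^sub>n\<^sub>+\<^sub>1 B\<^sub>n - A\<^sub>n B\<^sub>n\<^sub>+\<^sub>1 = (-1)\<^sup>n \<Pi>\<^sub>n\<^sub>+\<^sub>1\<close> makes the convergents the partial sums of an alternating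
  series with decreasing terms \<open>\<Pi>\<^sub>n\<^sub>+\<^sub>1 / (B\<^sub>n B\<^sub>n\<^sub>+\<^sub>1)\<close>.  The growth condition gives
  \<open>\<Pi>\<^sub>n \<le> B\<^sub>n\<^sup>\<sigma>\<close> for large \<open>n\<close>, for any \<open>\<sigma>\<close> strictly between \<open>\<nu>\<close> and \<open>1\<close>.  So the terms tend to zero,
  the convergents converge, and the Leibniz error bound reads
  \<open>\<bar>B\<^sub>n \<tau> - A\<^sub>n\<bar> \<le> \<Pi>\<^sub>n\<^sub>+\<^sub>1 / B\<^sub>n\<^sub>+\<^sub>1 \<le> B\<^sub>n\<^sub>+\<^sub>1\<^sup>-\<^sup>\<delta>\<close> with \<open>\<delta> = 1 - \<sigma>\<close>.

  Such small integer linear forms in \<open>1\<close> and \<open>\<tau>\<close> prevent \<open>\<tau>\<close> from being close to a fraction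
  \<open>M/N\<close> (lemma \<open>irrationality_exponent_criterion\<close>).  Two consecutive forms are linearly
  independent by the determinant identity, so for one of them the integer \<open>M B\<^sub>k - N A\<^sub>k\<close> is
  nonzero.  If moreover \<open>N \<bar>B\<^sub>k \<tau> - A\<^sub>k\<bar> \<le> 1/2\<close>, then \<open>B\<^sub>k \<bar>N \<tau> - M\<bar> \<ge> 1/2\<close>.  The first index at which
  the forms must be this small has \<open>B\<^sub>k\<close> at most about \<open>N\<^sup>1\<^sup>/\<^sup>\<delta>\<close>, because \<open>B\<^sub>n\<^sub>+\<^sub>1\<close> is at most
  \<open>B\<^sub>n\<^sup>1\<^sup>+\<^sup>\<epsilon>\<close>.  This gives the exponent \<open>1 + (1 + \<epsilon>)/\<delta>\<close>, which tends to
  \<open>1 + 1/(1 - \<nu>) = 2 + \<nu>/(1 - \<nu>)\<close>.  Irrationality comes for free, since a rational number has no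
  irrationality exponent at all.
\<close>

section \<open>Irrationality exponents from small linear forms\<close>

text \<open>
  A rational \<open>\<tau>\<close> coincides with fractions of arbitrarily large denominator, obtained by not
  cancelling common factors.
\<close>

lemma irrationality_exponent_imp_irrational:
  assumes "irrationality_exponent \<tau> \<mu>"
  shows "\<tau> \<notin> \<rat>"
proof
  assume "\<tau> \<in> \<rat>"
  then obtain p q :: int where q: "q > 0" and pq: "\<tau> = of_int p / of_int q"
    by (rule Rats_cases') auto
  from assms obtain c N0 :: real where c: "c > 0"
    and bd: "\<And>M N :: int. of_int N \<ge> N0 \<Longrightarrow> \<bar>\<tau> - of_int M / of_int N\<bar> \<ge> c / (of_int N powr \<mu>)"
    unfolding irrationality_exponent_def by blast
  define k :: int where "k = max 1 \<lceil>N0\<rceil>"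
  have k: "k \<ge> 1" "of_int k \<ge> N0"
    unfolding k_def by linarith+
  have "k * 1 \<le> k * q"
    using k q by (intro mult_left_mono) auto
  then have kq: "of_int k \<le> (of_int (k * q) :: real)"
    by (simp only: of_int_le_iff)
  have "c / (of_int (k * q) powr \<mu>) \<le> \<bar>\<tau> - of_int (k * p) / of_int (k * q)\<bar>"
    using k kq by (intro bd) linarith
  also have "\<dots> = 0"
    using k q pq by simp
  finally have "c / (of_int (k * q) powr \<mu>) \<le> 0" .
  moreover have "c / (of_int (k * q) powr \<mu>) > 0"
    using c k q by simp
  ultimately show False by simp
qed

text \<open>
  If \<open>\<tau>\<close> were too close to \<open>M / N\<close>, then \<open>M * B k - N * A k\<close> would be an integer of absolute value
  below \<open>1\<close> for two consecutive \<open>k\<close>, hence zero, against the linear independence of consecutive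
  forms.  Here \<open>k\<close> is taken just large enough for the form at \<open>k\<close> to be at most \<open>1 / (2 * N)\<close>; the growth
  condition keeps \<open>B k\<close>, and with it the loss in the estimate, close to \<open>N powr (1/\<delta>)\<close>.
\<close>

lemma irrationality_exponent_criterion:
  fixes A B :: "nat \<Rightarrow> int" and \<tau> \<delta> \<epsilon> :: real
  assumes B_pos: "\<And>n. B n > 0"
    and B_mono: "mono B"
    and B_lim: "filterlim (\<lambda>n. real_of_int (B n)) at_top sequentially"
    and indep: "\<And>n. A (Suc n) * B n \<noteq> A n * B (Suc n)"
    and \<delta>: "\<delta> > 0" and \<epsilon>: "\<epsilon> \<ge> 0"
    and small: "\<forall>\<^sub>F n in sequentially. \<bar>of_int (B n) * \<tau> - of_int (A n)\<bar> \<le> of_int (B (Suc n)) powr (-\<delta>)"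
    and growth: "\<forall>\<^sub>F n in sequentially. real_of_int (B (Suc n)) \<le> of_int (B n) powr (1 + \<epsilon>)"
  shows "irrationality_exponent \<tau> (1 + (1 + \<epsilon>) / \<delta>)"
proof -
  define e where "e = (1 + \<epsilon>) / \<delta>"
  from eventually_conj[OF small growth] obtain n1 where
    small': "\<And>n. n \<ge> n1 \<Longrightarrow> \<bar>of_int (B n) * \<tau> - of_int (A n)\<bar> \<le> of_int (B (Suc n)) powr (-\<delta>)"
    and growth': "\<And>n. n \<ge> n1 \<Longrightarrow> real_of_int (B (Suc n)) \<le> of_int (B n) powr (1 + \<epsilon>)"
    unfolding eventually_sequentially by blast
  have B_real: "real_of_int (B n) > 0" for n
    using B_pos[of n] by simp
  \<comment> \<open>Chosen so that the first index \<open>m\<close> with \<open>B m powr \<delta> \<ge> 2 * N\<close> comes after \<open>n1\<close>.\<close>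
  define N0 where "N0 = real_of_int (B n1) powr \<delta>"
  have N0: "N0 > 0"
    unfolding N0_def using B_real[of n1] by simp
  have "1 / (2 * 2 powr e) / (of_int N powr (1 + e)) \<le> \<bar>\<tau> - of_int M / of_int N\<bar>"
    if N: "of_int N \<ge> N0" for M N :: int
  proof -
    have Npos: "real_of_int N > 0" using N N0 by linarith
    have "\<exists>m. 2 * of_int N \<le> real_of_int (B m) powr \<delta>"
    proof -
      obtain m where "(2 * of_int N) powr (1 / \<delta>) \<le> real_of_int (B m)"
        using B_lim unfolding filterlim_at_top eventually_sequentially by blast
      then have "((2 * of_int N) powr (1 / \<delta>)) powr \<delta> \<le> real_of_int (B m) powr \<delta>"
        using \<delta> by (intro powr_mono2) auto
      then show ?thesis
        using \<delta> Npos by (auto simp: powr_powr)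
    qed
    define m where "m = (LEAST m. 2 * of_int N \<le> real_of_int (B m) powr \<delta>)"
    have m: "2 * of_int N \<le> real_of_int (B m) powr \<delta>"
      unfolding m_def by (rule LeastI_ex) fact
    have m_least: "real_of_int (B j) powr \<delta> < 2 * of_int N" if "j < m" for j
      using not_less_Least[OF that[unfolded m_def]] by simp
    have "n1 < m"
    proof (rule ccontr)
      assume "\<not> n1 < m"
      then have "B m \<le> B n1" using B_mono by (simp add: monoD)
      then have "real_of_int (B m) powr \<delta> \<le> N0"
        unfolding N0_def using B_real[of m] \<delta> by (intro powr_mono2) auto
      with m N Npos show False by linarith
    qed
    then obtain l where l: "m = Suc l" "l \<ge> n1"
      by (cases m) auto
    \<comment> \<open>Two independent forms cannot both vanish at the same fraction.\<close>
    have "A (Suc l) * B l \<noteq> A l * B (Suc l)" by (rule indep)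
    then obtain k where k: "k = l \<or> k = m" "M * B k - N * A k \<noteq> 0"
      unfolding l by (metis B_pos diff_eq_diff_eq eq_iff_diff_eq_0 mult.assoc mult.commute
          mult_cancel_left less_irrefl Npos of_int_0_less_iff)
    have Bk: "B k \<le> B m" and Bm: "B m \<le> B (Suc k)"
      using k(1) l(1) B_mono by (auto intro: monoD)
    have "of_int N * \<bar>of_int (B k) * \<tau> - of_int (A k)\<bar> \<le> of_int N * of_int (B (Suc k)) powr (-\<delta>)"
      using Npos k l by (intro mult_left_mono small') auto
    also have "\<dots> \<le> of_int N * of_int (B m) powr (-\<delta>)"
      using Npos Bm B_real[of m] \<delta> by (intro mult_left_mono powr_mono2') auto
    also have "\<dots> = of_int N / of_int (B m) powr \<delta>"
      by (simp add: powr_minus divide_inverse)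
    also have "\<dots> \<le> 1 / 2"
      using m Npos B_real[of m] by (simp add: field_simps)
    finally have half: "of_int N * \<bar>of_int (B k) * \<tau> - of_int (A k)\<bar> \<le> 1 / 2" .
    have "1 \<le> \<bar>M * B k - N * A k\<bar>" using k(2) by linarith
    then have "1 \<le> \<bar>real_of_int (M * B k - N * A k)\<bar>" by linarith
    also have "real_of_int (M * B k - N * A k)
        = of_int N * (of_int (B k) * \<tau> - of_int (A k)) - of_int (B k) * (of_int N * \<tau> - of_int M)"
      by (simp add: algebra_simps)
    also have "\<bar>\<dots>\<bar> \<le> \<bar>of_int N * (of_int (B k) * \<tau> - of_int (A k))\<bar>
        + \<bar>of_int (B k) * (of_int N * \<tau> - of_int M)\<bar>"
      by (rule abs_triangle_ineq4)
    also have "\<dots> = of_int N * \<bar>of_int (B k) * \<tau> - of_int (A k)\<bar>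
        + of_int (B k) * \<bar>of_int N * \<tau> - of_int M\<bar>"
      using Npos B_real[of k] by (simp add: abs_mult)
    finally have "1 / 2 \<le> of_int (B k) * \<bar>of_int N * \<tau> - of_int M\<bar>"
      using half by linarith
    also have "\<dots> \<le> of_int (B m) * \<bar>of_int N * \<tau> - of_int M\<bar>"
      using Bk by (intro mult_right_mono) auto
    also have "of_int N * \<tau> - of_int M = of_int N * (\<tau> - of_int M / of_int N)"
      using Npos by (simp add: field_simps)
    also have "\<bar>\<dots>\<bar> = of_int N * \<bar>\<tau> - of_int M / of_int N\<bar>"
      using Npos by (simp add: abs_mult)
    finally have lower: "1 / 2 \<le> of_int (B m) * (of_int N * \<bar>\<tau> - of_int M / of_int N\<bar>)" .
    \<comment> \<open>\<open>m\<close> is minimal, so the preceding coefficient is still below \<open>(2 N) powr (1/\<delta>)\<close>.\<close>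
    have "real_of_int (B l) powr (1 + \<epsilon>) = (of_int (B l) powr \<delta>) powr e"
      using \<delta> by (simp add: powr_powr e_def)
    also have "\<dots> \<le> (2 * of_int N) powr e"
      using m_least[of l] l \<delta> \<epsilon> by (intro powr_mono2) (auto simp: e_def)
    finally have "of_int (B m) \<le> (2 * of_int N) powr e"
      using growth'[OF l(2)] l(1) by simp
    then have "of_int (B m) * (of_int N * \<bar>\<tau> - of_int M / of_int N\<bar>)
        \<le> (2 * of_int N) powr e * (of_int N * \<bar>\<tau> - of_int M / of_int N\<bar>)"
      using Npos by (intro mult_right_mono) auto
    also have "\<dots> = 2 powr e * of_int N powr (1 + e) * \<bar>\<tau> - of_int M / of_int N\<bar>"
      using Npos by (simp add: powr_mult powr_add)
    finally have "1 / 2 \<le> 2 powr e * of_int N powr (1 + e) * \<bar>\<tau> - of_int M / of_int N\<bar>"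
      using lower by (rule order_trans[rotated])
    then have "1 \<le> \<bar>\<tau> - of_int M / of_int N\<bar> * (2 * 2 powr e * of_int N powr (1 + e))"
      by (simp add: mult_ac)
    moreover have "2 * 2 powr e * of_int N powr (1 + e) > 0"
      using Npos by simp
    ultimately show ?thesis
      unfolding divide_divide_eq_left by (simp only: pos_divide_le_eq)
  qed
  moreover have "1 / (2 * 2 powr e) > 0" by simp
  ultimately show ?thesis
    unfolding irrationality_exponent_def e_def[symmetric] using N0 by blast
qed

section \<open>Convergents of a continued fraction with positive terms\<close>

lemma gcf_determinant:
  "gcf_num a b (Suc n) * gcf_den a b n - gcf_num a b n * gcf_den a b (Suc n)
    = (-1) ^ n * (\<Prod>k=1..Suc n. a k)"
proof (induction n)
  case 0
  then show ?case by simp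
next
  case (Suc n)
  have "gcf_num a b (Suc (Suc n)) * gcf_den a b (Suc n)
      - gcf_num a b (Suc n) * gcf_den a b (Suc (Suc n))
    = - a (Suc (Suc n)) * (gcf_num a b (Suc n) * gcf_den a b n - gcf_num a b n * gcf_den a b (Suc n))"
    by (simp add: algebra_simps)
  also have "\<dots> = - a (Suc (Suc n)) * ((-1) ^ n * (\<Prod>k=1..Suc n. a k))"
    by (simp only: Suc.IH)
  also have "\<dots> = (-1) ^ Suc n * (\<Prod>k=1..Suc (Suc n). a k)"
    by (simp add: algebra_simps)
  finally show ?case .
qed

context
  fixes a b :: "nat \<Rightarrow> int"
  assumes a_pos: "\<And>n. n \<ge> 1 \<Longrightarrow> a n > 0"
    and b_pos: "\<And>n. n \<ge> 1 \<Longrightarrow> b n > 0"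
begin

lemma gcf_den_pos: "gcf_den a b n > 0"
proof (induction n rule: less_induct)
  case (less n)
  show ?case
  proof (cases "n \<le> 1")
    case True
    then show ?thesis using b_pos by (cases n) auto
  next
    case False
    then obtain k where n: "n = Suc (Suc k)"
      by (metis Suc_le_D not_less_eq_eq One_nat_def)
    have "b (k + 2) * gcf_den a b (Suc k) > 0" "a (k + 2) * gcf_den a b k > 0"
      using less a_pos b_pos n by simp_all
    then show ?thesis unfolding n gcf_den.simps by linarith
  qed
qed

lemma gcf_den_add_le: "gcf_den a b (Suc n) + gcf_den a b n \<le> gcf_den a b (Suc (Suc n))"
proof -
  have "1 * gcf_den a b (Suc n) \<le> b (n + 2) * gcf_den a b (Suc n)"
    using b_pos[of "n + 2"] gcf_den_pos[of "Suc n"] by (intro mult_right_mono) auto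
  moreover have "1 * gcf_den a b n \<le> a (n + 2) * gcf_den a b n"
    using a_pos[of "n + 2"] gcf_den_pos[of n] by (intro mult_right_mono) auto
  ultimately show ?thesis by simp
qed

lemma gcf_den_mono: "mono (gcf_den a b)"
proof (rule mono_iff_le_Suc[THEN iffD2], rule allI)
  fix n
  show "gcf_den a b n \<le> gcf_den a b (Suc n)"
  proof (cases n)
    case 0
    then show ?thesis using b_pos[of 1] by simp
  next
    case (Suc k)
    then show ?thesis using gcf_den_add_le[of k] gcf_den_pos[of k] by (simp del: gcf_den.simps)
  qed
qed

lemma gcf_den_ge: "int n \<le> gcf_den a b n"
proof (induction n rule: induct_nat_012)
  case 0
  then show ?case by simp
next
  case 1
  then show ?case using b_pos[of 1] by simp
next
  case (ge2 n)
  then show ?case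
    using gcf_den_add_le[of n] gcf_den_pos[of n] by linarith
qed

lemma gcf_den_at_top: "filterlim (\<lambda>n. real_of_int (gcf_den a b n)) at_top sequentially"
proof (rule filterlim_at_top_mono[OF filterlim_real_sequentially])
  have "real n \<le> real_of_int (gcf_den a b n)" for n
    using gcf_den_ge[of n] by linarith
  then show "\<forall>\<^sub>F n in sequentially. real n \<le> real_of_int (gcf_den a b n)"
    by simp
qed

lemma gcf_prod_pos: "(\<Prod>k=1..n. a k) > 0"
  using a_pos by (intro prod_pos) auto

text \<open>The distance between the convergents of index \<open>n\<close> and \<open>n + 1\<close>.\<close>

definition gcf_gap :: "nat \<Rightarrow> real" where
  "gcf_gap n = real_of_int (\<Prod>k=1..Suc n. a k)
     / (of_int (gcf_den a b n) * of_int (gcf_den a b (Suc n)))"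

lemma gcf_gap_nonneg: "0 \<le> gcf_gap n"
  unfolding gcf_gap_def using gcf_prod_pos[of "Suc n"] gcf_den_pos[of n] gcf_den_pos[of "Suc n"]
  by (intro divide_nonneg_nonneg mult_nonneg_nonneg) (simp_all only: of_int_0_le_iff less_imp_le)

lemma gcf_convergent_Suc: "gcf_convergent a b (Suc n) = gcf_convergent a b n + (-1) ^ n * gcf_gap n"
proof -
  have B: "real_of_int (gcf_den a b n) > 0" "real_of_int (gcf_den a b (Suc n)) > 0"
    using gcf_den_pos by simp_all
  have "gcf_convergent a b (Suc n) - gcf_convergent a b n
    = real_of_int (gcf_num a b (Suc n) * gcf_den a b n - gcf_num a b n * gcf_den a b (Suc n))
      / (of_int (gcf_den a b n) * of_int (gcf_den a b (Suc n)))"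
    unfolding gcf_convergent_def using B by (simp add: field_simps)
  also have "\<dots> = (-1) ^ n * gcf_gap n"
    unfolding gcf_determinant gcf_gap_def by simp
  finally show ?thesis by simp
qed

lemma gcf_convergent_eq_sum: "gcf_convergent a b n = (\<Sum>i<n. (-1) ^ i * gcf_gap i)"
proof (induction n)
  case 0
  then show ?case by (simp add: gcf_convergent_def)
qed (simp add: gcf_convergent_Suc)

text \<open>
  Passing from one gap to the next multiplies it by \<open>a\<^sub>n\<^sub>+\<^sub>2 B\<^sub>n / B\<^sub>n\<^sub>+\<^sub>2\<close>, which is below \<open>1\<close> because
  \<open>a\<^sub>n\<^sub>+\<^sub>2 B\<^sub>n\<close> is one of the two positive summands of \<open>B\<^sub>n\<^sub>+\<^sub>2\<close>.
\<close>

lemma gcf_gap_decreasing: "gcf_gap (Suc n) \<le> gcf_gap n"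
proof -
  define P where "P = real_of_int (\<Prod>k=1..Suc n. a k)"
  define B0 B1 B2 where "B0 = real_of_int (gcf_den a b n)"
    and "B1 = real_of_int (gcf_den a b (Suc n))" and "B2 = real_of_int (gcf_den a b (Suc (Suc n)))"
  have pos: "P > 0" "B0 > 0" "B1 > 0" "B2 > 0"
    unfolding P_def B0_def B1_def B2_def of_int_0_less_iff
    by (rule gcf_prod_pos gcf_den_pos)+
  have "b (n + 2) * gcf_den a b (Suc n) > 0"
    using b_pos[of "n + 2"] gcf_den_pos[of "Suc n"] by simp
  then have "a (n + 2) * gcf_den a b n \<le> gcf_den a b (Suc (Suc n))"
    by simp
  then have "real_of_int (a (n + 2) * gcf_den a b n) \<le> B2"
    unfolding B2_def by (simp only: of_int_le_iff)
  then have le: "real_of_int (a (n + 2)) * B0 \<le> B2"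
    by (simp add: B0_def)
  have "gcf_gap (Suc n) = P * of_int (a (n + 2)) / (B1 * B2)"
    unfolding gcf_gap_def P_def B1_def B2_def by (simp add: mult.commute)
  also have "\<dots> = P / (B0 * B1) * (of_int (a (n + 2)) * B0 / B2)"
    using pos by (simp add: field_simps)
  also have "\<dots> \<le> P / (B0 * B1) * 1"
    using pos le by (intro mult_left_mono) (auto simp: field_simps)
  also have "\<dots> = gcf_gap n"
    unfolding gcf_gap_def P_def B0_def B1_def by simp
  finally show ?thesis .
qed

lemma gcf_convergents_Leibniz:
  assumes "gcf_gap \<longlonglongrightarrow> 0"
  shows "gcf_convergent a b \<longlonglongrightarrow> gcf_value a b"
    and "\<bar>gcf_value a b - gcf_convergent a b n\<bar> \<le> gcf_gap n"
proof -
  note leibniz = summable_Leibniz'[OF assms gcf_gap_nonneg gcf_gap_decreasing]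
  define s where "s = (\<Sum>i. (-1) ^ i * gcf_gap i)"
  have "gcf_convergent a b \<longlonglongrightarrow> s"
    unfolding s_def gcf_convergent_eq_sum using leibniz(1) by (rule summable_LIMSEQ)
  then have value_eq: "gcf_value a b = s"
    unfolding gcf_value_def by (rule limI)
  show "gcf_convergent a b \<longlonglongrightarrow> gcf_value a b"
    unfolding value_eq by fact
  \<comment> \<open>The value lies between the convergents of index \<open>n\<close> and \<open>n + 1\<close>.\<close>
  show "\<bar>gcf_value a b - gcf_convergent a b n\<bar> \<le> gcf_gap n"
  proof (cases "even n")
    case True
    then obtain k where k: "n = 2 * k" by (elim evenE)
    have "gcf_convergent a b n \<le> s" "s \<le> gcf_convergent a b (Suc n)"
      unfolding gcf_convergent_eq_sum s_def k using leibniz(2)[of k] leibniz(4)[of k] by simp_all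
    then show ?thesis
      unfolding value_eq gcf_convergent_Suc using True by simp
  next
    case False
    then obtain k where k: "n = 2 * k + 1" by (elim oddE)
    have "gcf_convergent a b (Suc n) \<le> s" "s \<le> gcf_convergent a b n"
      unfolding gcf_convergent_eq_sum s_def k using leibniz(2)[of "Suc k"] leibniz(4)[of k] by simp_all
    then show ?thesis
      unfolding value_eq gcf_convergent_Suc using False by simp
  qed
qed

section \<open>Growth conditions and the irrationality exponent\<close>

lemma ln_gcf_den_pos: "\<forall>\<^sub>F n in sequentially. ln (real_of_int (gcf_den a b n)) > 0"
  using filterlim_at_top_dense[THEN iffD1, OF gcf_den_at_top, rule_format, of 1]
  by eventually_elim simp

lemma gcf_prod_le_powr:
  assumes limsup: "limsup (\<lambda>n. ereal (ln (real_of_int (\<Prod>k=1..n. a k)) / ln (real_of_int (gcf_den a b n))))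
      < ereal \<sigma>"
  shows "\<forall>\<^sub>F n in sequentially. real_of_int (\<Prod>k=1..n. a k) \<le> of_int (gcf_den a b n) powr \<sigma>"
  using Limsup_lessD[OF limsup] ln_gcf_den_pos
proof eventually_elim
  case (elim n)
  have P: "real_of_int (\<Prod>k=1..n. a k) > 0"
    unfolding of_int_0_less_iff by (rule gcf_prod_pos)
  have B: "real_of_int (gcf_den a b n) > 0"
    using gcf_den_pos by simp
  have "ln (real_of_int (\<Prod>k=1..n. a k)) \<le> \<sigma> * ln (real_of_int (gcf_den a b n))"
    using elim by (simp add: field_simps)
  then have "exp (ln (real_of_int (\<Prod>k=1..n. a k))) \<le> exp (\<sigma> * ln (real_of_int (gcf_den a b n)))"
    by (simp only: exp_le_cancel_iff)
  then show ?case
    using P B by (simp only: exp_ln powr_def) auto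
qed

lemma gcf_den_Suc_le_powr:
  assumes ratio: "(\<lambda>n. ln (real_of_int (gcf_den a b (n + 1))) / ln (real_of_int (gcf_den a b n)))
      \<longlonglongrightarrow> 1"
    and \<epsilon>: "\<epsilon> > 0"
  shows "\<forall>\<^sub>F n in sequentially. real_of_int (gcf_den a b (Suc n)) \<le> of_int (gcf_den a b n) powr (1 + \<epsilon>)"
proof -
  have "\<forall>\<^sub>F n in sequentially.
      ln (real_of_int (gcf_den a b (n + 1))) / ln (real_of_int (gcf_den a b n)) < 1 + \<epsilon>"
    using \<epsilon> by (intro order_tendstoD(2)[OF ratio]) simp
  with ln_gcf_den_pos show ?thesis
  proof eventually_elim
    case (elim n)
    have B: "real_of_int (gcf_den a b n) > 0" "real_of_int (gcf_den a b (Suc n)) > 0"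
      using gcf_den_pos by simp_all
    have "ln (real_of_int (gcf_den a b (Suc n))) \<le> (1 + \<epsilon>) * ln (real_of_int (gcf_den a b n))"
      using elim by (simp add: pos_divide_less_eq)
    then have "exp (ln (real_of_int (gcf_den a b (Suc n)))) \<le> exp ((1 + \<epsilon>) * ln (real_of_int (gcf_den a b n)))"
      by (simp only: exp_le_cancel_iff)
    then show ?case
      using B by (simp only: exp_ln powr_def) auto
  qed
qed

text \<open>
  The gap bounds \<open>\<bar>\<tau> - A\<^sub>n / B\<^sub>n\<bar>\<close>, so its product with \<open>B\<^sub>n\<close> bounds the linear form
  \<open>\<bar>B\<^sub>n \<tau> - A\<^sub>n\<bar>\<close>.  The bound is in terms of \<open>B\<^sub>n\<^sub>+\<^sub>1\<close>, as the irrationality criterion wants it.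
\<close>

lemma gcf_den_mult_gap_le_powr:
  assumes "\<forall>\<^sub>F n in sequentially. real_of_int (\<Prod>k=1..n. a k) \<le> of_int (gcf_den a b n) powr \<sigma>"
  shows "\<forall>\<^sub>F n in sequentially.
    of_int (gcf_den a b n) * gcf_gap n \<le> of_int (gcf_den a b (Suc n)) powr (- (1 - \<sigma>))"
  using eventually_compose_filterlim[OF assms filterlim_Suc]
proof eventually_elim
  case (elim n)
  have B: "real_of_int (gcf_den a b n) > 0" "real_of_int (gcf_den a b (Suc n)) > 0"
    using gcf_den_pos by simp_all
  have "of_int (gcf_den a b n) * gcf_gap n
      = real_of_int (\<Prod>k=1..Suc n. a k) / of_int (gcf_den a b (Suc n))"
    unfolding gcf_gap_def using B by simp
  also have "\<dots> \<le> of_int (gcf_den a b (Suc n)) powr \<sigma> / of_int (gcf_den a b (Suc n))"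
    using elim B by (intro divide_right_mono) auto
  also have "\<dots> = of_int (gcf_den a b (Suc n)) powr (- (1 - \<sigma>))"
    using B by (simp add: powr_diff)
  finally show ?case .
qed

lemma gcf_gap_tendsto_0:
  assumes prod: "\<forall>\<^sub>F n in sequentially. real_of_int (\<Prod>k=1..n. a k) \<le> of_int (gcf_den a b n) powr \<sigma>"
    and \<sigma>: "\<sigma> < 1"
  shows "gcf_gap \<longlonglongrightarrow> 0"
proof (rule tendsto_sandwich[OF _ _ tendsto_const])
  show "\<forall>\<^sub>F n in sequentially. 0 \<le> gcf_gap n"
    by (simp add: gcf_gap_nonneg)
  show "\<forall>\<^sub>F n in sequentially. gcf_gap n \<le> of_int (gcf_den a b (Suc n)) powr (- (1 - \<sigma>))"
    using gcf_den_mult_gap_le_powr[OF prod]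
  proof eventually_elim
    case (elim n)
    have "1 * gcf_gap n \<le> of_int (gcf_den a b n) * gcf_gap n"
      using gcf_den_pos[of n] gcf_gap_nonneg by (intro mult_right_mono) auto
    with elim show ?case by simp
  qed
  have "filterlim (\<lambda>n. real_of_int (gcf_den a b (Suc n))) at_top sequentially"
    by (rule filterlim_compose[OF gcf_den_at_top filterlim_Suc])
  then show "(\<lambda>n. real_of_int (gcf_den a b (Suc n)) powr (- (1 - \<sigma>))) \<longlonglongrightarrow> 0"
    using \<sigma> by (intro tendsto_neg_powr) auto
qed

lemma gcf_irrationality_exponent:
  assumes prod: "\<forall>\<^sub>F n in sequentially. real_of_int (\<Prod>k=1..n. a k) \<le> of_int (gcf_den a b n) powr \<sigma>"
    and growth: "\<forall>\<^sub>F n in sequentially.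
      real_of_int (gcf_den a b (Suc n)) \<le> of_int (gcf_den a b n) powr (1 + \<epsilon>)"
    and \<sigma>: "\<sigma> < 1" and \<epsilon>: "\<epsilon> \<ge> 0"
  shows "irrationality_exponent (gcf_value a b) (1 + (1 + \<epsilon>) / (1 - \<sigma>))"
proof (rule irrationality_exponent_criterion[OF gcf_den_pos gcf_den_mono gcf_den_at_top _ _ \<epsilon> _ growth])
  fix n
  have "(-1) ^ n * (\<Prod>k=1..Suc n. a k) \<noteq> 0"
    by (intro no_zero_divisors less_imp_neq[OF gcf_prod_pos, symmetric]) simp
  then show "gcf_num a b (Suc n) * gcf_den a b n \<noteq> gcf_num a b n * gcf_den a b (Suc n)"
    using gcf_determinant[of a b n] by linarith
next
  show "\<forall>\<^sub>F n in sequentially. \<bar>of_int (gcf_den a b n) * gcf_value a b - of_int (gcf_num a b n)\<bar>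
      \<le> of_int (gcf_den a b (Suc n)) powr - (1 - \<sigma>)"
    using gcf_den_mult_gap_le_powr[OF prod]
  proof eventually_elim
    case (elim n)
    have B: "real_of_int (gcf_den a b n) > 0"
      using gcf_den_pos by simp
    have "of_int (gcf_den a b n) * gcf_value a b - of_int (gcf_num a b n)
        = of_int (gcf_den a b n) * (gcf_value a b - gcf_convergent a b n)"
      unfolding gcf_convergent_def using B by (simp add: field_simps)
    also have "\<bar>\<dots>\<bar> = of_int (gcf_den a b n) * \<bar>gcf_value a b - gcf_convergent a b n\<bar>"
      using B by (simp add: abs_mult)
    also have "\<dots> \<le> of_int (gcf_den a b n) * gcf_gap n"
      using B gcf_convergents_Leibniz(2)[OF gcf_gap_tendsto_0[OF prod \<sigma>]] by (intro mult_left_mono) auto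
    finally show ?case using elim by linarith
  qed
qed (use \<sigma> in simp)

end

theorem lemma2p3:
  fixes a b :: "nat \<Rightarrow> int" and \<tau> \<nu> :: real
  assumes a_pos: "\<And>n. n \<ge> 1 \<Longrightarrow> a n > 0"
    and b_pos: "\<And>n. n \<ge> 1 \<Longrightarrow> b n > 0"
    and tau: "\<tau> = gcf_value a b"
    and log_ratio: "(\<lambda>n. ln (real_of_int (gcf_den a b (n + 1))) / ln (real_of_int (gcf_den a b n)))
          \<longlonglongrightarrow> 1"
    and log_prod: "limsup (\<lambda>n. ereal (ln (real_of_int (\<Prod>k=1..n. a k)) / ln (real_of_int (gcf_den a b n))))
          \<le> ereal \<nu>"
    and nu: "\<nu> < 1"
  shows "convergent (gcf_convergent a b) \<and> \<tau> \<notin> \<rat> \<and>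
         asymptotic_irrationality_exponent \<tau> \<le> ereal (2 + \<nu> / (1 - \<nu>))"
proof (intro conjI)
  note pos = a_pos b_pos
  have prod: "\<forall>\<^sub>F n in sequentially. real_of_int (\<Prod>k=1..n. a k) \<le> of_int (gcf_den a b n) powr (\<nu> + t)"
    if "t > 0" for t
  proof (rule gcf_prod_le_powr[OF pos])
    show "limsup (\<lambda>n. ereal (ln (real_of_int (\<Prod>k=1..n. a k)) / ln (real_of_int (gcf_den a b n))))
        < ereal (\<nu> + t)"
      using log_prod that by (elim le_less_trans) simp
  qed
  \<comment> \<open>One parameter \<open>t\<close> serves as the slack in both growth conditions: \<open>\<sigma> = \<nu> + t\<close> and \<open>\<epsilon> = t\<close>.\<close>
  have exponent: "irrationality_exponent \<tau> (1 + (1 + t) / (1 - (\<nu> + t)))" if "t > 0" "t < 1 - \<nu>" for t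
    unfolding tau using that
    by (intro gcf_irrationality_exponent[OF pos] prod gcf_den_Suc_le_powr[OF pos log_ratio]) auto
  define t0 where "t0 = (1 - \<nu>) / 2"
  have t0: "t0 > 0" "t0 < 1 - \<nu>"
    using nu by (auto simp: t0_def)
  have "gcf_gap a b \<longlonglongrightarrow> 0"
    using t0 by (intro gcf_gap_tendsto_0[OF pos prod]) auto
  then show "convergent (gcf_convergent a b)"
    unfolding convergent_def by (intro exI) (rule gcf_convergents_Leibniz(1)[OF pos])
  show "\<tau> \<notin> \<rat>"
    using irrationality_exponent_imp_irrational[OF exponent[OF t0]] .
  show "asymptotic_irrationality_exponent \<tau> \<le> ereal (2 + \<nu> / (1 - \<nu>))"
  proof (rule tendsto_lowerbound)
    have "((\<lambda>t. 1 + (1 + t) / (1 - (\<nu> + t))) \<longlongrightarrow> 1 + (1 + 0) / (1 - (\<nu> + 0))) (at_right 0)"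
      using nu by (intro tendsto_intros) auto
    also have "1 + (1 + 0) / (1 - (\<nu> + 0)) = 2 + \<nu> / (1 - \<nu>)"
      using nu by (simp add: field_simps)
    finally show "((\<lambda>t. ereal (1 + (1 + t) / (1 - (\<nu> + t)))) \<longlongrightarrow> ereal (2 + \<nu> / (1 - \<nu>))) (at_right 0)"
      by (rule tendsto_ereal)
    show "\<forall>\<^sub>F t in at_right 0.
        asymptotic_irrationality_exponent \<tau> \<le> ereal (1 + (1 + t) / (1 - (\<nu> + t)))"
      using eventually_at_right_less eventually_at_right_real[of 0 "1 - \<nu>"] nu
      by (auto elim!: eventually_mono intro!: INF_lower exponent
          simp: asymptotic_irrationality_exponent_def)
  qed simp
qed

end
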